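(* Let $A$ be a commutative $\mathbb Q$-algebra and let $a\in A$ be a non-zero-divisor such that the principal ideal $Aa$ is a radical ideal. Let $B=A[z]$ be the polynomial ring in one variable. Then the image of the $A$-linear map $\mathcal D=\partial_z-a:B\to B$ (i.e. $h\mapsto h'-ah$) is a Mathieu subspace of $B$ (as a $\mathbb Q$-algebra).
   Context: Let $k$ be a field and $R$ a commutative $k$-algebra. A $k$-vector subspace $\mathcal M\subseteq R$ is called a Mathieu subspace of $R$ if for every $f\in R$ the following holds: if $f^m\in\mathcal M$ for all $m\ge 1$, then for every $g\in R$ one has $f^mg\in\mathcal M$ for all sufficiently large $m$. *)

theory Defs
  imports "HOL-Computational_Algebra.Polynomial"
begin

text \<open>Formal derivative d/dz on A[z] for an arbitrary commutative ring A
 (the library pderiv requires no zero divisors).\<close>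
definition zderiv :: "'a::comm_ring_1 poly \<Rightarrow> 'a poly" where
  "zderiv p = (\<Sum>i<degree p. monom (of_nat (Suc i) * coeff p (Suc i)) i)"

text \<open>A commutative ring is a Q-algebra iff every positive integer is a unit.\<close>
definition rat_algebra :: "'a::comm_ring_1 itself \<Rightarrow> bool" where
  "rat_algebra _ \<longleftrightarrow> (\<forall>n::nat. n > 0 \<longrightarrow> (of_nat n :: 'a) dvd 1)"

text \<open>Q-vector subspace of a Q-algebra R: an additive subgroup that is
 closed under division by positive integers (hence under all rational scalars).\<close>
definition rat_subspace :: "'a::comm_ring_1 set \<Rightarrow> bool" where
  "rat_subspace M \<longleftrightarrow> 0 \<in> M \<and> (\<forall>x\<in>M. \<forall>y\<in>M. x + y \<in> M) \<and> (\<forall>x\<in>M. - x \<in> M)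
     \<and> (\<forall>n::nat. \<forall>y. n > 0 \<and> of_nat n * y \<in> M \<longrightarrow> y \<in> M)"

definition mathieu_subspace :: "'a::comm_ring_1 set \<Rightarrow> bool" where
  "mathieu_subspace M \<longleftrightarrow> rat_subspace M \<and>
     (\<forall>f. (\<forall>m::nat. m \<ge> 1 \<longrightarrow> f ^ m \<in> M) \<longrightarrow>
          (\<forall>g. \<exists>N. \<forall>m\<ge>N. f ^ m * g \<in> M))"

end

theory Submission
  imports Defs "HOL-Analysis.Analysis" "HOL-Computational_Algebra.Fundamental_Theorem_Algebra"
    "HOL-Library.Poly_Mapping" "HOL-Library.Multiset"
begin

text \<open>
  Let \<open>L\<close> be the linear functional with \<open>L(z\<^sup>k) = k!\<close>. Solving \<open>h' - a h = f\<close> for the coefficients of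
  \<open>h\<close> shows that \<open>f\<close> of degree at most \<open>n\<close> lies in the image of \<open>\<D>\<close> iff \<open>a\<^sup>n\<^sup>+\<^sup>1\<close> divides
  \<open>L(a\<^sup>n f(z / a))\<close>. The key fact is that if \<open>a\<close> divides \<open>L(p\<^sup>m)\<close> for all \<open>m \<ge> 1\<close>, then \<open>a\<close> divides
  \<open>p\<close>. Applying it repeatedly, if all \<open>f\<^sup>m\<close> are in the image and \<open>f\<close> has degree \<open>d\<close>, then \<open>a\<^sup>d\<^sup>+\<^sup>1\<close>
  divides \<open>a\<^sup>d f(z / a)\<close>, and then \<open>f\<^sup>m g\<close> is in the image for all \<open>m > degree g\<close>.

  The key fact says that modulo \<open>a\<close> the coefficients of \<open>p\<close> are nilpotent. By a Nullstellensatz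
  argument over the uncountable field of complex numbers, a counterexample produces a nonzero complex
  polynomial \<open>p\<close> with \<open>L(p\<^sup>m) = 0\<close> for all \<open>m \<ge> 1\<close>. Such a \<open>p\<close> does not exist: if
  \<open>p = z\<^sup>d + b z\<^sup>d\<^sup>-\<^sup>1 + \<dots>\<close> with \<open>d \<ge> 1\<close>, then \<open>L(p\<^sup>m) / (dm)!\<close> tends to \<open>exp(b / d) \<noteq> 0\<close>.
\<close>

section \<open>The factorial functional\<close>

text \<open>The formal version of \<open>p \<mapsto> \<integral>\<^sub>0\<^sup>\<infinity> p(z) e\<^sup>-\<^sup>z dz\<close>.\<close>

definition factorial_functional :: "'a::comm_ring_1 poly \<Rightarrow> 'a" where
  "factorial_functional p = (\<Sum>k\<le>degree p. of_nat (fact k) * coeff p k)"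

lemma factorial_functional_eq:
  assumes "degree p \<le> n"
  shows "factorial_functional p = (\<Sum>k\<le>n. of_nat (fact k) * coeff p k)"
  unfolding factorial_functional_def
  using assms by (intro sum.mono_neutral_left) (auto simp: coeff_eq_0)

lemma factorial_functional_smult:
  "factorial_functional (smult c p) = c * factorial_functional p"
  by (subst factorial_functional_eq[OF degree_smult_le])
    (simp add: factorial_functional_def sum_distrib_left mult_ac)

lemma degree_power_le_mult: "degree p \<le> d \<Longrightarrow> degree (p ^ m) \<le> d * m"
  using degree_power_le[of p m] by (meson le_trans mult_le_mono1)

text \<open>The value is an integer polynomial in the coefficients, so a relation compatible with
  the ring operations passes to it. \<open>R\<close> may link two different rings and need not be
  the graph of a homomorphism.\<close>

lemma factorial_functional_power_related:
  assumes R0: "R 0 0" and R1: "R 1 1"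
    and Radd: "\<And>x y x' y'. R x y \<Longrightarrow> R x' y' \<Longrightarrow> R (x + x') (y + y')"
    and Rmult: "\<And>x y x' y'. R x y \<Longrightarrow> R x' y' \<Longrightarrow> R (x * x') (y * y')"
    and Rcoeff: "\<And>i. R (coeff p i) (coeff q i)"
  shows "R (factorial_functional (p ^ m)) (factorial_functional (q ^ m))"
proof -
  have Rsum: "R (sum f A) (sum g A)" if "\<And>i. R (f i) (g i)" for f g and A :: "nat set"
    using that by (induction A rule: infinite_finite_induct) (auto simp: R0 Radd)
  have Rnat: "R (of_nat n) (of_nat n)" for n
    by (induction n) (auto simp: R0 R1 Radd)
  have Rpow: "R (coeff (p ^ m) i) (coeff (q ^ m) i)" for i
  proof (induction m arbitrary: i)
    case 0
    then show ?case by (cases i) (auto simp: R0 R1)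
  next
    case (Suc m)
    then show ?case by (auto simp: coeff_mult intro!: Rsum Rmult Rcoeff)
  qed
  define n where "n = max (degree (p ^ m)) (degree (q ^ m))"
  have "R (\<Sum>k\<le>n. of_nat (fact k) * coeff (p ^ m) k) (\<Sum>k\<le>n. of_nat (fact k) * coeff (q ^ m) k)"
    by (intro Rsum Rmult Rpow) (rule Rnat)
  then show ?thesis
    by (simp add: factorial_functional_eq[of _ n] n_def)
qed

section \<open>Complex polynomials\<close>

text \<open>When \<open>n\<close> grows by one, the left binomial is multiplied by
  \<open>(n + 1 + j) / (n + 1)\<close> and the right one by \<open>(n + 1) / (n + 1 - j)\<close>,
  which is at least as large; so the case \<open>n = j\<close> suffices.\<close>

lemma binomial_add_le_four_power:
  assumes "j \<le> n"
  shows "(n + j) choose j \<le> 4 ^ j * (n choose j)"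
  using assms
proof (induction n rule: dec_induct)
  case base
  show ?case using binomial_le_pow2[of "2 * j" j] by (simp add: power_mult flip: mult_2)
next
  case (step n)
  have e1: "(Suc n + j choose j) * Suc n = (n + j choose j) * (Suc n + j)"
    using binomial_absorb_comp[of "Suc n + j" j] by (simp add: mult.commute)
  have e2: "(Suc n choose j) * (Suc n - j) = (n choose j) * Suc n"
    using binomial_absorb_comp[of "Suc n" j] by (simp add: mult.commute)
  have le: "(Suc n + j) * (Suc n - j) \<le> Suc n * Suc n"
  proof -
    obtain r where "Suc n = j + r" using step by (metis le_Suc_eq le_iff_add)
    then show ?thesis by (simp add: algebra_simps)
  qed
  have "(Suc n + j choose j) * (Suc n * (Suc n - j)) = (n + j choose j) * ((Suc n + j) * (Suc n - j))"
    using e1 by (metis mult.assoc)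
  also have "\<dots> \<le> (4 ^ j * (n choose j)) * (Suc n * Suc n)"
    by (intro mult_mono step.IH le) auto
  also have "\<dots> = (4 ^ j * (Suc n choose j)) * (Suc n * (Suc n - j))"
    using e2 by (metis mult.assoc mult.commute)
  finally show ?case using step.hyps by (simp del: binomial_Suc_Suc)
qed

text \<open>The bound is the \<open>j\<close>-th coefficient of \<open>(1 - B z)^-(m + 1)\<close>: a
  geometric series dominates \<open>q\<close>, and the hockey-stick identity carries the
  induction.\<close>

lemma norm_coeff_power_le:
  fixes q :: "complex poly"
  assumes "\<And>i. norm (coeff q i) \<le> B ^ i" "B \<ge> 0"
  shows "norm (coeff (q ^ m) j) \<le> B ^ j * real (m + j choose j)"
proof (induction m arbitrary: j)
  case 0
  then show ?case using assms by (cases j) auto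
next
  case (Suc m)
  have "norm (coeff (q ^ Suc m) j) \<le> (\<Sum>i\<le>j. norm (coeff (q ^ m) i * coeff q (j - i)))"
    by (simp only: power_Suc2 coeff_mult norm_sum)
  also have "\<dots> \<le> (\<Sum>i\<le>j. B ^ j * real (m + i choose i))"
  proof (intro sum_mono)
    fix i assume "i \<in> {..j}"
    then have "B ^ j = B ^ i * B ^ (j - i)" by (simp flip: power_add)
    moreover have "norm (coeff (q ^ m) i) * norm (coeff q (j - i))
        \<le> (B ^ i * real (m + i choose i)) * B ^ (j - i)"
      using assms by (intro mult_mono Suc) auto
    ultimately show "norm (coeff (q ^ m) i * coeff q (j - i)) \<le> B ^ j * real (m + i choose i)"
      by (simp add: norm_mult mult_ac)
  qed
  also have "\<dots> = B ^ j * real (Suc m + j choose j)"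
    by (simp only: sum_choose_lower of_nat_sum[symmetric] sum_distrib_left[symmetric] add_Suc)
  finally show ?case .
qed

text \<open>Comparing coefficients in \<open>q (q^m)' = m q' q^m\<close>.\<close>

lemma coeff_power_recurrence:
  fixes q :: "complex poly"
  assumes "coeff q 0 = 1"
  shows "of_nat (Suc j) * coeff (q ^ m) (Suc j) =
    (\<Sum>i\<le>j. (of_nat m * of_nat (Suc i) - of_nat (j - i)) * coeff q (Suc i) * coeff (q ^ m) (j - i))"
proof -
  have "q * pderiv (q ^ m) = smult (of_nat m) (pderiv q * q ^ m)"
  proof (cases m)
    case (Suc k)
    then show ?thesis by (simp only: pderiv_power_Suc) (simp add: mult_ac)
  qed auto
  then have "coeff (q * pderiv (q ^ m)) j = coeff (smult (of_nat m) (pderiv q * q ^ m)) j"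
    by simp
  then have eq: "(\<Sum>i\<le>j. coeff q i * (of_nat (Suc (j - i)) * coeff (q ^ m) (Suc (j - i))))
      = (\<Sum>i\<le>j. of_nat m * (of_nat (Suc i) * coeff q (Suc i) * coeff (q ^ m) (j - i)))"
    by (simp only: coeff_mult coeff_pderiv coeff_smult sum_distrib_left)
  \<comment> \<open>At \<open>Suc j\<close> the factor \<open>Suc j - i\<close> is zero, so the sum
    extends by one index at no cost before the term at 0 is split off.\<close>
  define G where "G i = coeff q i * (of_nat (Suc j - i) * coeff (q ^ m) (Suc j - i))" for i
  have "(\<Sum>i\<le>j. coeff q i * (of_nat (Suc (j - i)) * coeff (q ^ m) (Suc (j - i)))) = (\<Sum>i\<le>Suc j. G i)"
    by (auto simp: G_def Suc_diff_le intro!: sum.cong)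
  also have "\<dots> = of_nat (Suc j) * coeff (q ^ m) (Suc j) + (\<Sum>i\<le>j. G (Suc i))"
    by (subst sum.atMost_Suc_shift) (simp only: G_def assms mult_1 diff_zero)
  finally have "of_nat (Suc j) * coeff (q ^ m) (Suc j) =
     (\<Sum>i\<le>j. of_nat m * (of_nat (Suc i) * coeff q (Suc i) * coeff (q ^ m) (j - i))) - (\<Sum>i\<le>j. G (Suc i))"
    unfolding eq by (simp only: add_diff_cancel_right')
  also have "\<dots> = (\<Sum>i\<le>j. (of_nat m * of_nat (Suc i) - of_nat (j - i)) * coeff q (Suc i) * coeff (q ^ m) (j - i))"
    unfolding sum_subtractf[symmetric] G_def diff_Suc_Suc
    by (intro sum.cong refl) (simp add: algebra_simps del: of_nat_Suc of_nat_diff)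
  finally show ?thesis .
qed

text \<open>After division by \<open>m^j\<close>, the summand of the recurrence with index
  \<open>i\<close> is of order at most \<open>m^(-i)\<close>. Only \<open>i = 0\<close> survives in
  the limit, so passing from \<open>j - 1\<close> to \<open>j\<close> multiplies the limit by
  \<open>coeff q 1 / j\<close>.\<close>

lemma coeff_power_asymptotics:
  fixes q :: "complex poly"
  assumes "coeff q 0 = 1"
  shows "(\<lambda>m. coeff (q ^ m) j / of_nat m ^ j) \<longlonglongrightarrow> coeff q 1 ^ j / fact j"
proof (induction j rule: less_induct)
  case (less j)
  show ?case
  proof (cases j)
    case 0
    have "coeff (q ^ m) 0 = 1" for m
      using assms by (induction m) (auto simp: coeff_mult)
    then show ?thesis by (simp add: 0)
  next
    case (Suc k)
    let ?f = "\<lambda>i m. (of_nat (Suc i) - of_nat (k - i) / of_nat m) * coeff q (Suc i)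
        * (coeff (q ^ m) (k - i) / of_nat m ^ (k - i)) * (1 / of_nat m) ^ i"
    have inv: "(\<lambda>m. c / of_nat m) \<longlonglongrightarrow> 0" for c :: complex
      by (rule lim_const_over_n)
    let ?l = "\<lambda>i. (of_nat (Suc i) - 0) * coeff q (Suc i)
        * (coeff q 1 ^ (k - i) / fact (k - i)) * 0 ^ i"
    have lim: "?f i \<longlonglongrightarrow> ?l i"
      if "i \<le> k" for i
      using Suc by (intro tendsto_mult tendsto_diff tendsto_power tendsto_const inv less) auto
    have "(\<lambda>m. \<Sum>i\<le>k. ?f i m) \<longlonglongrightarrow> (\<Sum>i\<le>k. ?l i)"
      by (intro tendsto_sum lim) auto
    also have "(\<Sum>i\<le>k. ?l i)
        = coeff q 1 * (coeff q 1 ^ k / fact k)"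
      by (subst sum.mono_neutral_right[of _ "{0}"]) auto
    finally have "(\<lambda>m. (\<Sum>i\<le>k. ?f i m) / of_nat j) \<longlonglongrightarrow> coeff q 1 * (coeff q 1 ^ k / fact k) / of_nat j"
      using Suc by (intro tendsto_divide tendsto_const) (auto simp del: of_nat_Suc)
    also have "coeff q 1 * (coeff q 1 ^ k / fact k) / of_nat j = coeff q 1 ^ j / fact j"
      by (simp add: Suc mult_ac)
    finally have L: "(\<lambda>m. (\<Sum>i\<le>k. ?f i m) / of_nat j) \<longlonglongrightarrow> coeff q 1 ^ j / fact j" .
    have "(\<Sum>i\<le>k. ?f i m) / of_nat j = coeff (q ^ m) j / of_nat m ^ j" if "m > 0" for m
    proof -
      have "of_nat j * coeff (q ^ m) j / of_nat m ^ j = (\<Sum>i\<le>k. ?f i m)"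
        unfolding Suc coeff_power_recurrence[OF assms] sum_divide_distrib
      proof (intro sum.cong refl)
        fix i assume "i \<in> {..k}"
        then have "(of_nat m :: complex) ^ Suc k = of_nat m ^ (k - i) * of_nat m ^ i * of_nat m"
          by (simp flip: power_add)
        then show "(of_nat m * of_nat (Suc i) - of_nat (k - i)) * coeff q (Suc i)
            * coeff (q ^ m) (k - i) / of_nat m ^ Suc k = ?f i m"
          using that by (simp only: power_divide power_one) (simp add: field_simps del: of_nat_Suc of_nat_diff)
      qed
      then show ?thesis using Suc by (simp add: divide_simps mult_ac del: of_nat_Suc)
    qed
    then show ?thesis
      by (intro Lim_transform_eventually[OF L]) (auto intro: eventually_mono[OF eventually_gt_at_top[of 0]])
  qed
qed

text \<open>For \<open>m > j\<close>, replacing \<open>j\<close> by \<open>j + 1\<close> multiplies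
  the quotient by \<open>m / (d m - j) = 1 / (d - j / m)\<close>, which tends to
  \<open>1 / d\<close>.\<close>

lemma fact_ratio_asymptotics:
  assumes "d > 0"
  shows "(\<lambda>m. of_nat m ^ j * fact (d * m - j) / fact (d * m)) \<longlonglongrightarrow> 1 / (of_nat d ^ j :: complex)"
proof (induction j)
  case (Suc j)
  have l: "(\<lambda>m. 1 / (of_nat d - of_nat j / of_nat m)) \<longlonglongrightarrow> 1 / (of_nat d - 0 :: complex)"
    using assms by (intro tendsto_intros lim_const_over_n) auto
  have L: "(\<lambda>m. of_nat m ^ j * fact (d * m - j) / fact (d * m) * (1 / (of_nat d - of_nat j / of_nat m)))
     \<longlonglongrightarrow> 1 / (of_nat d ^ j :: complex) * (1 / (of_nat d - 0))"
    by (intro tendsto_mult Suc l)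
  have "of_nat m ^ j * fact (d * m - j) / fact (d * m) * (1 / (of_nat d - of_nat j / of_nat m))
      = of_nat m ^ Suc j * fact (d * m - Suc j) / (fact (d * m) :: complex)" if "m > j" for m
  proof -
    have "m \<le> d * m" using assms by simp
    with that have lt: "j < d * m" by linarith
    then obtain r where r: "d * m = Suc (j + r)" using less_iff_Suc_add by auto
    then have f: "(fact (d * m - j) :: complex) = (of_nat d * of_nat m - of_nat j) * fact (d * m - Suc j)"
      by (simp flip: of_nat_mult add: Suc_diff_le)
    have "(of_nat d * of_nat m - of_nat j :: complex) \<noteq> 0"
      using lt by (metis eq_iff_diff_eq_0 less_irrefl of_nat_eq_iff of_nat_mult)
    then show ?thesis
      unfolding f using that by (simp add: divide_simps mult_ac)
  qed
  then show ?case
    using L by (intro Lim_transform_eventually[OF L[unfolded diff_zero], THEN tendsto_eq_rhs])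
      (auto intro: eventually_mono[OF eventually_gt_at_top[of j]])
qed auto

text \<open>After making \<open>p\<close> monic, coefficients are counted from the top, so that the
  index \<open>j\<close> stays fixed as \<open>m\<close> grows. The terms converge one by one to
  those of an exponential series and are dominated uniformly in \<open>m\<close>, so Tannery's
  theorem applies.\<close>

lemma complex_factorial_functional_power_zero:
  fixes p :: "complex poly"
  assumes "\<And>m. m \<ge> 1 \<Longrightarrow> factorial_functional (p ^ m) = 0"
  shows "p = 0"
proof (rule ccontr)
  assume "p \<noteq> 0"
  define d where "d = degree p"
  have "d \<noteq> 0"
  proof
    assume "d = 0"
    then have "coeff p 0 = 0" using assms[of 1] by (simp add: factorial_functional_def d_def)
    with \<open>p \<noteq> 0\<close> \<open>d = 0\<close> show False unfolding d_def by (metis leading_coeff_0_iff)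
  qed
  define r where "r = smult (1 / lead_coeff p) p"
  have r: "degree r = d" "lead_coeff r = 1" "r \<noteq> 0"
    using \<open>p \<noteq> 0\<close> by (auto simp: r_def d_def)
  have r0: "factorial_functional (r ^ m) = 0" if "m \<ge> 1" for m
    using assms[OF that] by (simp add: r_def smult_power factorial_functional_smult)
  define q where "q = reflect_poly r"
  have q0: "coeff q 0 = 1" using r by (simp add: q_def)
  have qm: "coeff (q ^ m) j = coeff (r ^ m) (d * m - j)" if "j \<le> d * m" for m j
    using that r by (simp add: q_def flip: reflect_poly_power)
      (simp add: coeff_reflect_poly degree_power_eq mult.commute)
  \<comment> \<open>\<open>T j m\<close> is the contribution of the power \<open>d m - j\<close> to
    the functional of \<open>r ^ m\<close>, divided by \<open>(d m)!\<close>.\<close>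
  define T :: "nat \<Rightarrow> nat \<Rightarrow> complex" where
    "T j m = (if j \<le> d * m then coeff (q ^ m) j * fact (d * m - j) / fact (d * m) else 0)" for j m
  have sumT: "suminf (\<lambda>j. T j m) = 0" if "m \<ge> 1" for m
  proof -
    have "suminf (\<lambda>j. T j m) = (\<Sum>j\<le>d * m. T j m)"
      by (rule suminf_finite) (auto simp: T_def)
    also have "\<dots> = (\<Sum>j\<le>d * m. coeff (r ^ m) (d * m - j) * fact (d * m - j)) / fact (d * m)"
      unfolding sum_divide_distrib by (intro sum.cong) (auto simp: T_def qm)
    also have "(\<Sum>j\<le>d * m. coeff (r ^ m) (d * m - j) * fact (d * m - j)) = (\<Sum>k\<le>d * m. coeff (r ^ m) k * fact k)"
      by (intro sum.reindex_bij_witness[of _ "\<lambda>k. d * m - k" "\<lambda>k. d * m - k"]) auto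
    also have "\<dots> = factorial_functional (r ^ m)"
      using degree_power_le_mult[of r d m] r by (simp add: factorial_functional_eq[of _ "d * m"] mult.commute)
    finally show ?thesis using r0[OF that] by simp
  qed
  \<comment> \<open>The summand 1 gives \<open>B \<ge> 1\<close>, so a bound by \<open>B\<close> is
    also one by \<open>B ^ i\<close> for \<open>i \<ge> 1\<close>.\<close>
  define B where "B = 1 + (\<Sum>i\<le>degree q. norm (coeff q i))"
  have "B \<ge> 1" by (simp add: B_def sum_nonneg)
  have qB: "norm (coeff q i) \<le> B ^ i" for i
  proof (cases "i = 0 \<or> i > degree q")
    case True
    then show ?thesis using q0 \<open>B \<ge> 1\<close> by (auto simp: coeff_eq_0)
  next
    case False
    then have "norm (coeff q i) \<le> (\<Sum>i\<le>degree q. norm (coeff q i))"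
      by (intro member_le_sum) auto
    also have "\<dots> \<le> B" by (simp add: B_def)
    also have "B \<le> B ^ i" using False \<open>B \<ge> 1\<close> by (intro self_le_power) auto
    finally show ?thesis .
  qed
  \<comment> \<open>The binomial \<open>d m choose j\<close> cancels against the quotient of
    factorials and leaves \<open>1 / j!\<close>, free of \<open>m\<close>.\<close>
  have bound: "norm (T j m) \<le> (4 * B) ^ j / fact j" for j m
  proof (cases "j \<le> d * m")
    case True
    have "m \<le> d * m" using \<open>d \<noteq> 0\<close> by simp
    then have "(m + j choose j) \<le> (d * m + j choose j)" by (intro binomial_right_mono) simp
    also have "\<dots> \<le> 4 ^ j * (d * m choose j)" by (rule binomial_add_le_four_power[OF True])
    finally have "real (m + j choose j) \<le> 4 ^ j * real (d * m choose j)"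
      by (metis of_nat_le_iff of_nat_mult of_nat_numeral of_nat_power)
    then have "norm (coeff (q ^ m) j) \<le> B ^ j * (4 ^ j * real (d * m choose j))"
      using norm_coeff_power_le[of q B m j] qB \<open>B \<ge> 1\<close>
      by (meson mult_left_mono order_trans zero_le_one zero_le_power)
    then have "norm (coeff (q ^ m) j) * (fact (d * m - j) / fact (d * m))
        \<le> B ^ j * (4 ^ j * real (d * m choose j)) * (fact (d * m - j) / fact (d * m))"
      by (rule mult_right_mono) simp
    also have "\<dots> = (4 * B) ^ j / fact j"
      using True by (simp add: binomial_fact power_mult_distrib field_simps)
    finally show ?thesis using True by (simp add: T_def norm_mult norm_divide)
  qed (use \<open>B \<ge> 1\<close> in \<open>simp add: T_def\<close>)
  have lim: "(\<lambda>m. T j m) \<longlonglongrightarrow> (coeff q 1 / of_nat d) ^ j /\<^sub>R fact j" for j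
  proof -
    have L: "(\<lambda>m. coeff (q ^ m) j / of_nat m ^ j * (of_nat m ^ j * fact (d * m - j) / fact (d * m)))
        \<longlonglongrightarrow> coeff q 1 ^ j / fact j * (1 / of_nat d ^ j)"
      using \<open>d \<noteq> 0\<close> by (intro tendsto_mult coeff_power_asymptotics fact_ratio_asymptotics q0) auto
    have "coeff (q ^ m) j / of_nat m ^ j * (of_nat m ^ j * fact (d * m - j) / fact (d * m)) = T j m"
      if "m > j" for m
    proof -
      have "m \<le> d * m" using \<open>d \<noteq> 0\<close> by simp
      with that have "j \<le> d * m" by linarith
      with that show ?thesis by (simp add: T_def)
    qed
    then have "(\<lambda>m. T j m) \<longlonglongrightarrow> coeff q 1 ^ j / fact j * (1 / of_nat d ^ j)"
      by (intro Lim_transform_eventually[OF L]) (auto intro: eventually_mono[OF eventually_gt_at_top[of j]])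
    also have "coeff q 1 ^ j / fact j * (1 / of_nat d ^ j) = (coeff q 1 / of_nat d) ^ j /\<^sub>R fact j"
      by (simp add: scaleR_conv_of_real power_divide field_simps)
    finally show ?thesis .
  qed
  have "summable (\<lambda>j. (4 * B) ^ j / fact j)"
    using summable_exp[of "4 * B"] by (simp add: divide_inverse mult.commute)
  then have "(\<lambda>m. suminf (\<lambda>j. T j m)) \<longlonglongrightarrow>
      suminf (\<lambda>j. (coeff q 1 / of_nat d) ^ j /\<^sub>R fact j)"
    using tannerys_theorem[of T _ sequentially "\<lambda>j. (4 * B) ^ j / fact j", OF lim] bound
    by (simp add: case_prod_unfold)
  moreover have "(\<lambda>m. suminf (\<lambda>j. T j m)) \<longlonglongrightarrow> 0"
    by (rule tendsto_eventually) (use sumT in \<open>auto intro: eventually_mono[OF eventually_ge_at_top[of 1]]\<close>)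
  ultimately have "exp (coeff q 1 / of_nat d) = 0"
    unfolding exp_def by (rule LIMSEQ_unique)
  then show False by simp
qed

section \<open>Residue fields of complex polynomial rings\<close>

definition ring_ideal :: "'a::comm_ring_1 set \<Rightarrow> bool" where
  "ring_ideal I \<longleftrightarrow> 0 \<in> I \<and> (\<forall>x\<in>I. \<forall>y\<in>I. x + y \<in> I) \<and> (\<forall>x\<in>I. \<forall>y. x * y \<in> I)"

lemma ring_idealD:
  assumes "ring_ideal I"
  shows "0 \<in> I" "x \<in> I \<Longrightarrow> y \<in> I \<Longrightarrow> x + y \<in> I" "x \<in> I \<Longrightarrow> x * y \<in> I" "x \<in> I \<Longrightarrow> y * x \<in> I"
    "x \<in> I \<Longrightarrow> - x \<in> I" "x \<in> I \<Longrightarrow> y \<in> I \<Longrightarrow> x - y \<in> I"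
proof -
  show 1: "0 \<in> I" "x \<in> I \<Longrightarrow> y \<in> I \<Longrightarrow> x + y \<in> I" "x \<in> I \<Longrightarrow> x * y \<in> I" for x y
    using assms by (auto simp: ring_ideal_def)
  show "x \<in> I \<Longrightarrow> y * x \<in> I" using 1(3)[of x y] by (simp add: mult.commute)
  show 2: "x \<in> I \<Longrightarrow> - x \<in> I" for x using 1(3)[of x "- 1"] by simp
  show "x \<in> I \<Longrightarrow> y \<in> I \<Longrightarrow> x - y \<in> I" using 1(2)[of x "- y"] 2[of y] by simp
qed

lemma ring_ideal_sum:
  assumes "ring_ideal I" "\<And>i. i \<in> A \<Longrightarrow> f i \<in> I"
  shows "sum f A \<in> I"
  using assms(2) by (induction A rule: infinite_finite_induct) (auto intro: ring_idealD[OF assms(1)])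

text \<open>\<open>M\<close> corresponds to a maximal ideal of the localization at \<open>x\<close>:
  by the last clause, every \<open>u\<close> outside \<open>M\<close> becomes a unit modulo
  \<open>M\<close> once \<open>x\<close> is inverted. Stating this by elements avoids forming either
  ring.\<close>

definition maximal_avoiding_powers :: "'a::comm_ring_1 \<Rightarrow> 'a set \<Rightarrow> bool" where
  "maximal_avoiding_powers x M \<longleftrightarrow> ring_ideal M \<and> (\<forall>n. x ^ n \<notin> M) \<and>
     (\<forall>u. u \<notin> M \<longrightarrow> (\<exists>n v. x ^ n - u * v \<in> M))"

lemma maximal_avoiding_powers_exists:
  fixes x :: "'a::comm_ring_1"
  assumes J: "ring_ideal J" "\<And>n. x ^ n \<notin> J"
  obtains M where "J \<subseteq> M" "maximal_avoiding_powers x M"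
proof -
  define \<A> where "\<A> = {I. ring_ideal I \<and> J \<subseteq> I \<and> (\<forall>n. x ^ n \<notin> I)}"
  have "\<exists>M\<in>\<A>. \<forall>X\<in>\<A>. M \<subseteq> X \<longrightarrow> X = M"
  proof (rule subset_Zorn_nonempty)
    show "\<A> \<noteq> {}" using J by (auto simp: \<A>_def)
    fix \<C> assume ne: "\<C> \<noteq> {}" and chain: "subset.chain \<A> \<C>"
    have sub: "\<C> \<subseteq> \<A>" using chain by (auto simp: subset.chain_def)
    have idl: "ring_ideal I" if "I \<in> \<C>" for I using sub that by (auto simp: \<A>_def)
    have "ring_ideal (\<Union>\<C>)"
      unfolding ring_ideal_def
    proof (intro conjI ballI allI)
      show "0 \<in> \<Union>\<C>" using ne idl by (auto simp: ring_ideal_def)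
    next
      fix y z assume "y \<in> \<Union>\<C>" "z \<in> \<Union>\<C>"
      then obtain I K where "I \<in> \<C>" "K \<in> \<C>" "y \<in> I" "z \<in> K" by blast
      moreover have "I \<subseteq> K \<or> K \<subseteq> I"
        using chain \<open>I \<in> \<C>\<close> \<open>K \<in> \<C>\<close> by (auto simp: subset.chain_def)
      ultimately show "y + z \<in> \<Union>\<C>" using ring_idealD(2)[OF idl] by (meson UnionI subsetD)
    next
      fix y z assume "y \<in> \<Union>\<C>"
      then show "y * z \<in> \<Union>\<C>" using ring_idealD(3)[OF idl] by (meson UnionE UnionI)
    qed
    then show "\<Union>\<C> \<in> \<A>" using sub ne by (auto simp: \<A>_def)
  qed
  then obtain M where M: "M \<in> \<A>" and max: "\<And>X. X \<in> \<A> \<Longrightarrow> M \<subseteq> X \<Longrightarrow> X = M" by blast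
  then have idl: "ring_ideal M" by (auto simp: \<A>_def)
  have "\<exists>n v. x ^ n - u * v \<in> M" if "u \<notin> M" for u
  proof -
    \<comment> \<open>\<open>K\<close> is the ideal generated by \<open>M\<close> and
      \<open>u\<close>; by maximality of \<open>M\<close> it contains a power of
      \<open>x\<close>.\<close>
    define K where "K = {y. \<exists>v. y - u * v \<in> M}"
    have "ring_ideal K"
      unfolding ring_ideal_def K_def
    proof (intro conjI ballI allI; clarsimp)
      show "\<exists>v. - (u * v) \<in> M"
        using ring_idealD(1)[OF idl] by (intro exI[of _ 0]) simp
    next
      fix y z v w assume "y - u * v \<in> M" "z - u * w \<in> M"
      then have "(y - u * v) + (z - u * w) \<in> M" by (rule ring_idealD(2)[OF idl])
      then show "\<exists>v. y + z - u * v \<in> M" by (intro exI[of _ "v + w"]) (simp add: algebra_simps)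
    next
      fix y z v assume "y - u * v \<in> M"
      then have "(y - u * v) * z \<in> M" by (rule ring_idealD(3)[OF idl])
      then show "\<exists>v. y * z - u * v \<in> M" by (intro exI[of _ "v * z"]) (simp add: algebra_simps)
    qed
    moreover have "M \<subseteq> K" unfolding K_def by (auto intro: exI[of _ 0])
    moreover have "u \<in> K" unfolding K_def using ring_idealD(1)[OF idl] by (auto intro: exI[of _ 1])
    ultimately have "K \<notin> \<A>" using max[of K] that by auto
    then obtain n where "x ^ n \<in> K"
      using \<open>ring_ideal K\<close> \<open>M \<subseteq> K\<close> M by (auto simp: \<A>_def)
    then show ?thesis by (auto simp: K_def)
  qed
  then have "maximal_avoiding_powers x M"
    using M by (auto simp: \<A>_def maximal_avoiding_powers_def)
  with M show thesis by (intro that) (auto simp: \<A>_def)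
qed

text \<open>For \<open>u\<close> and \<open>v\<close> outside \<open>M\<close>, some powers of
  \<open>x\<close> are congruent to multiples of \<open>u\<close> and of \<open>v\<close>; their
  product would be a power of \<open>x\<close> congruent to a multiple of
  \<open>u * v\<close>.\<close>

lemma maximal_avoiding_powers_prime:
  assumes M: "maximal_avoiding_powers x M" and uv: "u * v \<in> M"
  shows "u \<in> M \<or> v \<in> M"
proof (rule ccontr)
  assume "\<not> (u \<in> M \<or> v \<in> M)"
  then obtain n u' m v' where *: "x ^ n - u * u' \<in> M" "x ^ m - v * v' \<in> M"
    using M unfolding maximal_avoiding_powers_def by metis
  have idl: "ring_ideal M" using M by (simp add: maximal_avoiding_powers_def)
  have "(x ^ n - u * u') * x ^ m + (x ^ m - v * v') * (u * u') + (u * v) * (u' * v') \<in> M"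
    by (intro ring_idealD(2)[OF idl] ring_idealD(3)[OF idl] * uv)
  then have "x ^ (n + m) \<in> M" by (simp add: algebra_simps power_add)
  then show False using M by (auto simp: maximal_avoiding_powers_def)
qed

text \<open>Complex polynomials in countably many variables; a monomial is the multiset of the indices
  of its variables.\<close>

type_synonym cmpoly = "nat multiset \<Rightarrow>\<^sub>0 complex"

abbreviation cmconst :: "complex \<Rightarrow> cmpoly" where
  "cmconst \<equiv> Poly_Mapping.single 0"

abbreviation cmvar :: "nat \<Rightarrow> cmpoly" where
  "cmvar i \<equiv> Poly_Mapping.single {#i#} 1"

lemma cmconst_mult: "cmconst (a * b) = cmconst a * cmconst b"
  by (simp add: mult_single)

lemma poly_mapping_sum_single:
  "(\<Sum>k\<in>Poly_Mapping.keys g. Poly_Mapping.single k (Poly_Mapping.lookup g k)) = g"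
  by (rule poly_mapping_eqI)
    (auto simp: lookup_sum lookup_single when_def not_in_keys_iff_lookup_eq_zero)

definition cmeval :: "cmpoly \<Rightarrow> complex poly \<Rightarrow> cmpoly" where
  "cmeval t q = poly (map_poly cmconst q) t"

lemma cmeval_0: "cmeval t 0 = 0"
  and cmeval_pCons: "cmeval t (pCons a q) = cmconst a + t * cmeval t q"
  by (simp_all add: cmeval_def map_poly_pCons)

lemma cmeval_add: "cmeval t (p + q) = cmeval t p + cmeval t q"
proof -
  have "map_poly cmconst (p + q) = map_poly cmconst p + map_poly cmconst q"
    by (rule poly_eqI) (simp add: coeff_map_poly single_add)
  then show ?thesis by (simp add: cmeval_def)
qed

lemma cmeval_smult: "cmeval t (smult a q) = cmconst a * cmeval t q"
  by (induction q) (simp_all add: cmeval_0 cmeval_pCons cmconst_mult algebra_simps)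

lemma cmeval_mult: "cmeval t (p * q) = cmeval t p * cmeval t q"
  by (induction p) (simp_all add: cmeval_0 cmeval_pCons cmeval_add cmeval_smult algebra_simps)

lemma cmeval_sum: "cmeval t (sum f A) = (\<Sum>i\<in>A. cmeval t (f i))"
  by (induction A rule: infinite_finite_induct) (auto simp: cmeval_0 cmeval_add)

lemma cmeval_prod: "cmeval t (prod f A) = (\<Prod>i\<in>A. cmeval t (f i))"
  by (induction A rule: infinite_finite_induct)
    (auto simp: cmeval_0 cmeval_pCons cmeval_mult one_pCons)

lemma cmeval_linear: "cmeval t [:- z, 1:] = t - cmconst z"
  by (simp add: cmeval_0 cmeval_pCons single_uminus)

text \<open>This makes \<open>t\<close> transcendental modulo \<open>M\<close>: over the complex
  numbers \<open>q\<close> splits into linear factors, each takes a value outside \<open>M\<close>,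
  and \<open>M\<close> is prime.\<close>

lemma cmeval_not_in_ideal:
  assumes M: "maximal_avoiding_powers x M" and t: "\<And>z. t - cmconst z \<notin> M" and "q \<noteq> 0"
  shows "cmeval t q \<notin> M"
  using \<open>q \<noteq> 0\<close>
proof (induction "degree q" arbitrary: q)
  case 0
  then obtain c where c: "q = [:c:]" "c \<noteq> 0" by (metis degree_eq_zeroE pCons_0_0)
  show ?case
  proof
    assume "cmeval t q \<in> M"
    then have "cmconst c * cmconst (1 / c) \<in> M"
      using M unfolding maximal_avoiding_powers_def
      by (intro ring_idealD(3)) (auto simp: c cmeval_0 cmeval_pCons)
    also have "cmconst c * cmconst (1 / c) = x ^ 0"
      using c by (simp add: mult_single)
    finally show False using M unfolding maximal_avoiding_powers_def by blast
  qed
next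
  case (Suc n)
  then obtain z where "poly q z = 0" using alg_closed_imp_poly_has_root[of q] by auto
  then obtain r where r: "q = [:- z, 1:] * r" by (metis dvdE poly_eq_0_iff_dvd)
  then have "r \<noteq> 0" using Suc.prems by auto
  then have "degree q = Suc (degree r)" unfolding r by (subst degree_mult_eq) auto
  then have "cmeval t r \<notin> M" using Suc \<open>r \<noteq> 0\<close> by auto
  then show ?case
    unfolding r cmeval_mult cmeval_linear
    using maximal_avoiding_powers_prime[OF M] t by blast
qed

text \<open>Otherwise every \<open>t - z\<close> divides a power of \<open>x\<close> modulo \<open>M\<close>. There are
  uncountably many \<open>z\<close> but only countably many monomials, so infinitely many of the cofactors lie in
  a common finite-dimensional space; a linear relation between them yields a nonzero polynomial in
  \<open>t\<close> that belongs to \<open>M\<close>.\<close>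

lemma maximal_avoiding_powers_residue:
  fixes x t :: cmpoly
  assumes M: "maximal_avoiding_powers x M"
  shows "\<exists>z. t - cmconst z \<in> M"
proof (rule ccontr)
  assume "\<not> (\<exists>z. t - cmconst z \<in> M)"
  then have t: "\<And>z. t - cmconst z \<notin> M" by blast
  have idl: "ring_ideal M" and pow: "\<And>n. x ^ n \<notin> M"
    using M by (auto simp: maximal_avoiding_powers_def)
  have "\<exists>n v. x ^ n - (t - cmconst z) * v \<in> M" for z
    using M t by (auto simp: maximal_avoiding_powers_def)
  then obtain n v where nv: "\<And>z. x ^ n z - (t - cmconst z) * v z \<in> M" by metis
  define S where "S = (UNIV :: nat set) \<times> {F :: nat multiset set. finite F}"
  \<comment> \<open>The constants are sorted by the exponent of \<open>x\<close> and by the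
    monomials of the cofactor, so both are the same throughout one infinite fibre.\<close>
  define Z where "Z s = {z. (n z, Poly_Mapping.keys (v z)) = s}" for s
  have "countable (UNIV :: nat multiset set)"
    using countable_image[of UNIV mset] surj_mset by (metis countableI_type)
  then have "countable S"
    unfolding S_def using countable_Collect_finite_subset[of "UNIV :: nat multiset set"]
    by (intro countable_SIGMA) auto
  moreover have "(\<Union>s\<in>S. Z s) = UNIV" by (auto simp: S_def Z_def)
  ultimately obtain s where "infinite (Z s)"
    using uncountable_UNIV_complex countable_UN[of S Z] by (metis countable_finite)
  then obtain N K where inf: "infinite (Z (N, K))" by (metis surj_pair)
  define L where "L = Z (N, K)"
  have L: "n z = N" "Poly_Mapping.keys (v z) = K" if "z \<in> L" for z
    using that by (auto simp: L_def Z_def)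
  have "infinite L" using inf by (simp add: L_def)
  then obtain z0 where "z0 \<in> L" by fastforce
  then have "finite K" using L(2) by (metis finite_keys)
  \<comment> \<open>A common cofactor of two distinct constants would have a nonzero constant
    multiple in \<open>M\<close>, hence lie in \<open>M\<close>, and then so would
    \<open>x ^ N\<close>.\<close>
  have "inj_on v L"
  proof (rule inj_onI, rule ccontr)
    fix y z assume yz: "y \<in> L" "z \<in> L" "v y = v z" "y \<noteq> z"
    have "(x ^ N - (t - cmconst y) * v z) - (x ^ N - (t - cmconst z) * v z) \<in> M"
      using nv[of y] nv[of z] L(1) yz by (metis ring_idealD(6)[OF idl])
    then have "cmconst (y - z) * v z \<in> M" by (simp add: algebra_simps single_diff)
    then have "(t - cmconst z) * cmconst (1 / (y - z)) * (cmconst (y - z) * v z) \<in> M"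
      by (rule ring_idealD(4)[OF idl])
    also have "(t - cmconst z) * cmconst (1 / (y - z)) * (cmconst (y - z) * v z)
        = (t - cmconst z) * (cmconst (1 / (y - z)) * cmconst (y - z)) * v z"
      by (simp only: mult_ac)
    also have "cmconst (1 / (y - z)) * cmconst (y - z) = 1"
      using yz by (simp add: mult_single)
    finally have "(x ^ N - (t - cmconst z) * v z) + (t - cmconst z) * v z \<in> M"
      using nv[of z] L(1) yz by (metis mult_1_right ring_idealD(2)[OF idl])
    then show False using pow[of N] by simp
  qed
  interpret vs: vector_space "\<lambda>a (g :: cmpoly). cmconst a * g"
    by unfold_locales (auto simp: algebra_simps single_add cmconst_mult)
  have "vs.dependent (v ` L)"
  proof (rule ccontr)
    assume ind: "\<not> vs.dependent (v ` L)"
    have "g \<in> vs.span ((\<lambda>k. Poly_Mapping.single k 1) ` K)" if "Poly_Mapping.keys g = K" for g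
    proof -
      have "g = (\<Sum>k\<in>K. cmconst (Poly_Mapping.lookup g k) * Poly_Mapping.single k 1)"
        using poly_mapping_sum_single[of g] that by (simp add: mult_single)
      also have "\<dots> \<in> vs.span ((\<lambda>k. Poly_Mapping.single k 1) ` K)"
        by (intro vs.span_sum vs.span_scale vs.span_base) auto
      finally show ?thesis .
    qed
    then have "v ` L \<subseteq> vs.span ((\<lambda>k. Poly_Mapping.single k 1) ` K)" using L by auto
    then have "finite (v ` L)"
      using vs.independent_span_bound[OF _ ind] \<open>finite K\<close> by blast
    then show False using \<open>inj_on v L\<close> \<open>infinite L\<close> finite_image_iff by blast
  qed
  then obtain T \<alpha> w where T: "finite T" "T \<subseteq> v ` L" "w \<in> T" "\<alpha> w \<noteq> 0"
    "(\<Sum>y\<in>T. cmconst (\<alpha> y) * y) = 0"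
    unfolding vs.dependent_explicit by blast
  define P where "P = {z\<in>L. v z \<in> T}"
  have vP: "v ` P = T" and injP: "inj_on v P"
    using T \<open>inj_on v L\<close> by (auto simp: P_def inj_on_def)
  then have finP: "finite P" using T(1) finite_image_iff by blast
  define \<beta> where "\<beta> z = \<alpha> (v z)" for z
  have rel: "(\<Sum>z\<in>P. cmconst (\<beta> z) * v z) = 0"
    using T(5) sum.reindex[OF injP, of "\<lambda>y. cmconst (\<alpha> y) * y"] by (simp add: vP \<beta>_def)
  obtain z1 where z1: "z1 \<in> P" "\<beta> z1 \<noteq> 0" using T vP by (auto simp: \<beta>_def)
  define R where "R z = (\<Prod>y\<in>P - {z}. t - cmconst y)" for z
  \<comment> \<open>Multiplying the membership at \<open>z\<close> by \<open>\<beta> z * R z\<close>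
    and summing, the cofactors combine to the relation \<open>rel\<close>; what remains is the value
    of \<open>q\<close> at \<open>t\<close> times \<open>x ^ N\<close>. At \<open>z1\<close> all
    summands of \<open>q\<close> but one vanish, so \<open>q\<close> is nonzero.\<close>
  define q where "q = (\<Sum>z\<in>P. smult (\<beta> z) (\<Prod>y\<in>P - {z}. [:- y, 1:]))"
  have ev: "cmeval t q = (\<Sum>z\<in>P. cmconst (\<beta> z) * R z)"
    by (simp add: q_def R_def cmeval_sum cmeval_smult cmeval_prod cmeval_linear)
  have "poly q z1 = (\<Sum>z\<in>P. \<beta> z * (\<Prod>y\<in>P - {z}. z1 - y))"
    by (simp add: q_def poly_sum poly_prod)
  also have "\<dots> = \<beta> z1 * (\<Prod>y\<in>P - {z1}. z1 - y)"
    using finP z1 by (subst sum.remove[of _ z1]) (auto intro!: sum.neutral)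
  also have "\<dots> \<noteq> 0" using finP z1 by simp
  finally have "q \<noteq> 0" by auto
  then have nin: "cmeval t q \<notin> M" by (rule cmeval_not_in_ideal[OF M t])
  have split: "R z * (t - cmconst z) = (\<Prod>y\<in>P. t - cmconst y)" if "z \<in> P" for z
    unfolding R_def using that finP by (simp add: prod.remove[of P z] mult.commute)
  have "(\<Sum>z\<in>P. (cmconst (\<beta> z) * R z) * (x ^ N - (t - cmconst z) * v z)) \<in> M"
  proof (intro ring_ideal_sum[OF idl] ring_idealD(4)[OF idl])
    show "x ^ N - (t - cmconst z) * v z \<in> M" if "z \<in> P" for z
      using nv[of z] L(1)[of z] that by (simp add: P_def)
  qed
  also have "(\<Sum>z\<in>P. (cmconst (\<beta> z) * R z) * (x ^ N - (t - cmconst z) * v z))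
      = (\<Sum>z\<in>P. cmconst (\<beta> z) * R z * x ^ N - (R z * (t - cmconst z)) * (cmconst (\<beta> z) * v z))"
    by (intro sum.cong) (auto simp: algebra_simps)
  also have "\<dots> = cmeval t q * x ^ N - (\<Prod>y\<in>P. t - cmconst y) * (\<Sum>z\<in>P. cmconst (\<beta> z) * v z)"
    by (simp add: split sum_subtractf ev sum_distrib_left sum_distrib_right)
  finally have "cmeval t q * x ^ N \<in> M" by (simp add: rel)
  then show False using maximal_avoiding_powers_prime[OF M] nin pow by blast
qed

section \<open>The factorial functional over rational algebras\<close>

lemma rat_algebra_inverse:
  assumes "rat_algebra TYPE('a::comm_ring_1)" "n > 0"
  obtains u where "of_nat n * u = (1::'a::comm_ring_1)"
  using assms unfolding rat_algebra_def by (metis dvdE)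

text \<open>The map is a rational linear projection of the complex numbers onto the line through 1,
  followed by the canonical map from the rationals to the algebra.\<close>

lemma rat_algebra_additive_functional:
  assumes Q: "rat_algebra TYPE('a::comm_ring_1)"
  obtains \<kappa> :: "complex \<Rightarrow> 'a::comm_ring_1" where "\<And>x y. \<kappa> (x + y) = \<kappa> x + \<kappa> y" "\<kappa> 1 = 1"
proof -
  \<comment> \<open>\<open>A r y\<close> says that \<open>y\<close> is the image of
    \<open>r\<close>, tested on all fractions \<open>k / n\<close> equal to \<open>r\<close>, so
    that well-definedness is settled once.\<close>
  define A where "A r y \<longleftrightarrow> (\<forall>n k. n > 0 \<longrightarrow> of_int k = of_nat n * r \<longrightarrow> of_nat n * y = of_int k)"
    for r :: rat and y :: 'a
  have cancel: "y = z" if eq: "of_nat n * y = of_nat n * z" and n: "n > 0" for n and y z :: 'a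
  proof -
    obtain u :: 'a where u: "of_nat n * u = 1" by (rule rat_algebra_inverse[OF Q n])
    have "w = u * (of_nat n * w)" for w
      using u by (metis mult.assoc mult.commute mult_1)
    then show ?thesis using eq by metis
  qed
  have repr: "\<exists>n k. n > 0 \<and> of_int k = of_nat n * r" for r :: rat
  proof -
    obtain k m where "r = Fract k m" "m > 0" by (cases r)
    then show ?thesis by (intro exI[of _ "nat m"] exI[of _ k]) (simp add: Fract_of_int_quotient)
  qed
  have "\<exists>y. A r y" for r
  proof -
    obtain m l where m: "m > 0" "of_int l = of_nat m * r" using repr by blast
    obtain u :: 'a where u: "of_nat m * u = 1" by (rule rat_algebra_inverse[OF Q m(1)])
    have "of_nat n * (u * of_int l) = (of_int k :: 'a)" if "of_int k = of_nat n * r" for n k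
    proof (rule cancel[OF _ m(1)])
      have "(of_int (int m * k) :: rat) = of_int (int n * l)"
        using m that by simp
      then have "int m * k = int n * l" by (simp only: of_int_eq_iff)
      then have "(of_int (int m * k) :: 'a) = of_int (int n * l)" by simp
      then have "of_nat m * of_int k = (of_nat n * of_int l :: 'a)" by simp
      moreover have "of_nat m * (of_nat n * (u * of_int l)) = of_nat n * of_int l * (of_nat m * u)"
        by (simp only: mult_ac)
      ultimately show "of_nat m * (of_nat n * (u * of_int l)) = (of_nat m * of_int k :: 'a)"
        by (simp add: u)
    qed
    then show ?thesis by (auto simp: A_def)
  qed
  then obtain \<iota> where \<iota>: "\<And>r. A r (\<iota> r)" by metis
  have \<iota>_add: "\<iota> (r + s) = \<iota> r + \<iota> s" for r s
  proof -
    obtain n k where n: "n > 0" "of_int k = of_nat n * r" using repr by blast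
    obtain m l where m: "m > 0" "of_int l = of_nat m * s" using repr by blast
    have rs: "(of_int (int m * k + int n * l) :: rat) = of_nat (n * m) * (r + s)"
      using n m by (simp add: algebra_simps)
    have "of_nat (n * m) * \<iota> (r + s) = of_int (int m * k + int n * l)"
      using \<iota>[of "r + s"] n m rs unfolding A_def by (metis nat_0_less_mult_iff)
    moreover have "of_nat n * \<iota> r = of_int k" "of_nat m * \<iota> s = of_int l"
      using \<iota> n m by (auto simp: A_def)
    moreover have "of_nat (n * m) * (\<iota> r + \<iota> s) = of_nat m * (of_nat n * \<iota> r) + of_nat n * (of_nat m * \<iota> s)"
      by (simp add: algebra_simps)
    ultimately show ?thesis using cancel[of "n * m"] n m by simp
  qed
  have \<iota>_1: "\<iota> 1 = 1"
    using \<iota>[of 1] unfolding A_def by (metis mult_1 of_int_1 of_nat_1 zero_less_one)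
  interpret vsp: vector_space_pair "\<lambda>r (x::complex). of_rat r * x" "(*) :: rat \<Rightarrow> rat \<Rightarrow> rat"
    by unfold_locales (auto simp: algebra_simps of_rat_add of_rat_mult)
  have "vsp.vs1.independent {1}" by (rule vsp.vs1.independent_insertI[of 1 "{}"])
    (auto simp: vsp.vs1.independent_empty)
  then obtain \<pi> where \<pi>: "Vector_Spaces.linear (\<lambda>r (x::complex). of_rat r * x) (*) \<pi>" "\<pi> 1 = (1::rat)"
    using vsp.linear_independent_extend[of "{1}" "\<lambda>_. 1"] by auto
  interpret lin: Vector_Spaces.linear "\<lambda>r (x::complex). of_rat r * x" "(*)" \<pi> by (rule \<pi>(1))
  show thesis
    by (rule that[of "\<iota> \<circ> \<pi>"]) (auto simp: \<iota>_add \<iota>_1 \<pi>(2) lin.add)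
qed

text \<open>Since \<open>\<kappa>\<close> is only additive, this is not a ring homomorphism, but it is linear over the
  polynomials with integer coefficients, which suffices as the factorials are integers.\<close>

definition twisted_eval :: "(complex \<Rightarrow> 'a::comm_ring_1) \<Rightarrow> (nat \<Rightarrow> 'a) \<Rightarrow> cmpoly \<Rightarrow> 'a" where
  "twisted_eval \<kappa> c g = (\<Sum>\<mu>\<in>Poly_Mapping.keys g. \<kappa> (Poly_Mapping.lookup g \<mu>) * (\<Prod>i\<in>#\<mu>. c i))"

context
  fixes \<kappa> :: "complex \<Rightarrow> 'a::comm_ring_1" and c :: "nat \<Rightarrow> 'a"
  assumes \<kappa>_add: "\<And>x y. \<kappa> (x + y) = \<kappa> x + \<kappa> y"
begin

private lemma \<kappa>_0: "\<kappa> 0 = 0"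
  using \<kappa>_add[of 0 0] by simp

lemma twisted_eval_superset:
  assumes "finite A" "Poly_Mapping.keys g \<subseteq> A"
  shows "twisted_eval \<kappa> c g = (\<Sum>\<mu>\<in>A. \<kappa> (Poly_Mapping.lookup g \<mu>) * (\<Prod>i\<in>#\<mu>. c i))"
  unfolding twisted_eval_def using assms
  by (intro sum.mono_neutral_left) (auto simp: \<kappa>_0 not_in_keys_iff_lookup_eq_zero)

lemma twisted_eval_add: "twisted_eval \<kappa> c (g + h) = twisted_eval \<kappa> c g + twisted_eval \<kappa> c h"
proof -
  let ?A = "Poly_Mapping.keys g \<union> Poly_Mapping.keys h"
  have "Poly_Mapping.keys (g + h) \<subseteq> ?A" by (rule keys_add)
  then show ?thesis
    by (simp add: twisted_eval_superset[of ?A] lookup_add \<kappa>_add distrib_right sum.distrib)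
qed

lemma twisted_eval_0: "twisted_eval \<kappa> c 0 = 0"
  by (simp add: twisted_eval_def)

lemma twisted_eval_sum: "twisted_eval \<kappa> c (sum f A) = (\<Sum>i\<in>A. twisted_eval \<kappa> c (f i))"
  by (induction A rule: infinite_finite_induct) (auto simp: twisted_eval_0 twisted_eval_add)

lemma twisted_eval_single:
  "twisted_eval \<kappa> c (Poly_Mapping.single \<mu> z) = \<kappa> z * (\<Prod>i\<in>#\<mu>. c i)"
  by (simp add: twisted_eval_def \<kappa>_0)

text \<open>Multiplying by a variable moves monomials but leaves the complex coefficients alone, so
  additivity of \<open>\<kappa>\<close> is enough.\<close>

lemma twisted_eval_mult_cmvar: "twisted_eval \<kappa> c (g * cmvar i) = twisted_eval \<kappa> c g * c i"
proof -
  let ?s = "\<lambda>\<mu>. Poly_Mapping.single \<mu> (Poly_Mapping.lookup g \<mu>)"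
  have "twisted_eval \<kappa> c (g * cmvar i) = twisted_eval \<kappa> c (\<Sum>\<mu>\<in>Poly_Mapping.keys g. ?s \<mu> * cmvar i)"
    by (subst poly_mapping_sum_single[of g, symmetric]) (simp only: sum_distrib_right)
  also have "\<dots> = (\<Sum>\<mu>\<in>Poly_Mapping.keys g. twisted_eval \<kappa> c (?s \<mu>) * c i)"
    by (simp add: twisted_eval_sum mult_single twisted_eval_single mult_ac)
  also have "\<dots> = twisted_eval \<kappa> c g * c i"
    unfolding twisted_eval_single by (simp add: twisted_eval_def sum_distrib_right)
  finally show ?thesis .
qed

end

text \<open>The coefficients of \<open>p\<close> become variables and divisibility by
  \<open>a\<close> becomes membership in \<open>J\<close>. If \<open>a\<close> does not divide
  \<open>coeff p j\<close>, a suitable ideal \<open>M\<close> above \<open>J\<close> specializes the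
  variables to complex numbers with \<open>z j\<close> nonzero, and the complex polynomial
  \<open>f\<close> with these coefficients contradicts the complex case.\<close>

lemma factorial_functional_power_dvd:
  fixes a :: "'a::comm_ring_1"
  assumes Q: "rat_algebra TYPE('a)"
    and rad: "\<forall>(x::'a) (n::nat). n \<ge> 1 \<and> a dvd x ^ n \<longrightarrow> a dvd x"
    and p: "\<And>m. m \<ge> 1 \<Longrightarrow> a dvd factorial_functional (p ^ m)"
  shows "a dvd coeff p j"
proof (rule ccontr)
  assume j: "\<not> a dvd coeff p j"
  obtain \<kappa> :: "complex \<Rightarrow> 'a" where \<kappa>: "\<And>x y. \<kappa> (x + y) = \<kappa> x + \<kappa> y" "\<kappa> 1 = 1"
    by (rule rat_algebra_additive_functional[OF Q]) blast
  define \<Psi> where "\<Psi> = twisted_eval \<kappa> (coeff p)"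
  note \<Psi>_add = twisted_eval_add[where \<kappa> = \<kappa> and c = "coeff p", OF \<kappa>(1), folded \<Psi>_def]
    and \<Psi>_0 = twisted_eval_0[where \<kappa> = \<kappa> and c = "coeff p", OF \<kappa>(1), folded \<Psi>_def]
    and \<Psi>_var = twisted_eval_mult_cmvar[where \<kappa> = \<kappa> and c = "coeff p", OF \<kappa>(1), folded \<Psi>_def]
  have \<Psi>_1: "\<Psi> 1 = 1"
    using twisted_eval_single[where \<kappa> = \<kappa> and c = "coeff p" and \<mu> = 0 and z = 1, OF \<kappa>(1)] \<kappa>(2)
    by (simp add: \<Psi>_def)
  \<comment> \<open>As \<open>\<Psi>\<close> is not multiplicative, the set of \<open>g\<close> with
    \<open>a dvd \<Psi> g\<close> need not be an ideal; \<open>J\<close> is the largest ideal inside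
    it.\<close>
  define J where "J = {g. \<forall>w. a dvd \<Psi> (w * g)}"
  have J: "ring_ideal J"
    unfolding ring_ideal_def J_def
    by (auto simp: \<Psi>_0 \<Psi>_add distrib_left) (metis mult.assoc mult.commute)
  have \<Psi>_pow: "\<Psi> (cmvar j ^ n) = coeff p j ^ n" for n
    by (induction n) (simp_all add: \<Psi>_1 \<Psi>_var power_Suc2 del: power_Suc)
  have avoid: "cmvar j ^ n \<notin> J" for n
  proof
    assume "cmvar j ^ n \<in> J"
    then have "a dvd \<Psi> (1 * cmvar j ^ n)" unfolding J_def by blast
    then have dvd: "a dvd coeff p j ^ n" by (simp add: \<Psi>_pow)
    \<comment> \<open>The exponent is raised because \<open>rad\<close> asks for a positive one and
      \<open>n\<close> may be 0.\<close>
    then have "a dvd coeff p j ^ Suc n" by simp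
    then show False using rad j by (metis le_add1 plus_1_eq_Suc)
  qed
  obtain M where "J \<subseteq> M" and M: "maximal_avoiding_powers (cmvar j) M"
    using maximal_avoiding_powers_exists[OF J avoid] .
  have idl: "ring_ideal M" using M by (simp add: maximal_avoiding_powers_def)
  have "\<forall>i. \<exists>z. cmvar i - cmconst z \<in> M"
    using maximal_avoiding_powers_residue[OF M] by blast
  then obtain z where z: "\<And>i. cmvar i - cmconst (z i) \<in> M" by metis
  define d where "d = degree p"
  define F where "F = (\<Sum>i\<le>d. monom (cmvar i) i)"
  define f where "f = (\<Sum>i\<le>d. monom (z i) i)"
  have F: "coeff F i = (if i \<le> d then cmvar i else 0)" and f: "coeff f i = (if i \<le> d then z i else 0)" for i
    by (simp_all add: F_def f_def coeff_sum)
  have "factorial_functional (f ^ m) = 0" if m: "m \<ge> 1" for m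
  proof (rule ccontr)
    assume nz: "factorial_functional (f ^ m) \<noteq> 0"
    \<comment> \<open>The relation says that multiplication by \<open>g\<close> becomes
      multiplication by \<open>b\<close> under \<open>\<Psi>\<close>; it is closed under products
      although \<open>\<Psi>\<close> is not multiplicative.\<close>
    have "\<forall>w. \<Psi> (w * factorial_functional (F ^ m)) = \<Psi> w * factorial_functional (p ^ m)"
    proof (rule factorial_functional_power_related[where R = "\<lambda>g b. \<forall>w. \<Psi> (w * g) = \<Psi> w * b"])
      show "\<forall>w. \<Psi> (w * coeff F i) = \<Psi> w * coeff p i" for i
        by (auto simp: F \<Psi>_var \<Psi>_0 d_def coeff_eq_0)
    qed (auto simp: \<Psi>_0 \<Psi>_add distrib_left simp flip: mult.assoc)
    then have "factorial_functional (F ^ m) \<in> J" using p[OF m] by (simp add: J_def)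
    then have FM: "factorial_functional (F ^ m) \<in> M" using \<open>J \<subseteq> M\<close> by blast
    have "factorial_functional (F ^ m) - cmconst (factorial_functional (f ^ m)) \<in> M"
    proof (rule factorial_functional_power_related[where R = "\<lambda>g b. g - cmconst b \<in> M"])
      show "coeff F i - cmconst (coeff f i) \<in> M" for i
        using z by (auto simp: F f ring_idealD(1)[OF idl])
      show "g * h - cmconst (b * b') \<in> M" if "g - cmconst b \<in> M" "h - cmconst b' \<in> M" for g h b b'
      proof -
        have "(g - cmconst b) * h + cmconst b * (h - cmconst b') \<in> M"
          using that by (intro ring_idealD(2-4)[OF idl])
        then show ?thesis by (simp add: cmconst_mult algebra_simps)
      qed
      show "g + h - cmconst (b + b') \<in> M" if "g - cmconst b \<in> M" "h - cmconst b' \<in> M" for g h b b'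
        using ring_idealD(2)[OF idl that] by (simp add: single_add algebra_simps)
    qed (auto simp: ring_idealD(1)[OF idl])
    then have "factorial_functional (F ^ m)
        - (factorial_functional (F ^ m) - cmconst (factorial_functional (f ^ m))) \<in> M"
      by (rule ring_idealD(6)[OF idl FM])
    then have "cmconst (factorial_functional (f ^ m)) * cmconst (1 / factorial_functional (f ^ m)) \<in> M"
      by (intro ring_idealD(3)[OF idl]) simp
    then have "cmvar j ^ 0 \<in> M" using nz by (simp add: mult_single)
    then show False using M unfolding maximal_avoiding_powers_def by blast
  qed
  then have "f = 0" by (rule complex_factorial_functional_power_zero)
  moreover have "j \<le> d" using j by (metis d_def dvd_0_right le_degree)
  ultimately have "z j = 0" using f[of j] by simp
  then have "cmvar j ^ 1 \<in> M" using z[of j] by simp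
  then show False using M unfolding maximal_avoiding_powers_def by blast
qed

section \<open>The image of the twisted derivation\<close>

text \<open>This is \<open>a\<^sup>n f(z / a)\<close> when \<open>degree f \<le> n\<close>.\<close>

definition homogenize_poly :: "'a::comm_ring_1 \<Rightarrow> nat \<Rightarrow> 'a poly \<Rightarrow> 'a poly" where
  "homogenize_poly a n f = (\<Sum>k\<le>n. monom (a ^ (n - k) * coeff f k) k)"

lemma coeff_homogenize_poly:
  "coeff (homogenize_poly a n f) k = (if k \<le> n then a ^ (n - k) * coeff f k else 0)"
  by (simp add: homogenize_poly_def coeff_sum)

lemma degree_homogenize_poly: "degree (homogenize_poly a n f) \<le> n"
  by (rule degree_le) (simp add: coeff_homogenize_poly)

text \<open>For indices \<open>i\<close> and \<open>k - i\<close> within the degree bounds, the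
  powers of \<open>a\<close> multiply to \<open>a ^ (n + l - k)\<close> whatever \<open>i\<close>
  is; outside the bounds a coefficient vanishes.\<close>

lemma homogenize_poly_mult:
  assumes "degree f \<le> n" "degree g \<le> l"
  shows "homogenize_poly a (n + l) (f * g) = homogenize_poly a n f * homogenize_poly a l g"
proof (rule poly_eqI)
  fix k
  let ?h = "homogenize_poly a"
  have *: "coeff (?h n f) i * coeff (?h l g) (k - i)
      = a ^ (n + l - k) * (coeff f i * coeff g (k - i))" if "i \<le> k" for i
  proof (cases "i \<le> n \<and> k - i \<le> l")
    case True
    with that have "n - i + (l - (k - i)) = n + l - k" by arith
    then have "a ^ (n - i) * a ^ (l - (k - i)) = a ^ (n + l - k)"
      by (simp flip: power_add)
    with True show ?thesis
      by (simp add: coeff_homogenize_poly) (metis mult.assoc mult.left_commute)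
  next
    case False
    then have "coeff f i = 0 \<or> coeff g (k - i) = 0"
      using assms by (meson coeff_eq_0 le_less_trans not_le)
    then show ?thesis by (auto simp: coeff_homogenize_poly)
  qed
  have **: "coeff (?h n f * ?h l g) k = a ^ (n + l - k) * coeff (f * g) k"
    using * by (simp add: coeff_mult sum_distrib_left)
  have "coeff (f * g) k = 0" if "k > n + l"
    using that assms degree_mult_le[of f g] by (intro coeff_eq_0) linarith
  then show "coeff (?h (n + l) (f * g)) k = coeff (?h n f * ?h l g) k"
    unfolding ** by (auto simp: coeff_homogenize_poly not_le)
qed

lemma homogenize_poly_power:
  assumes "degree f \<le> n"
  shows "homogenize_poly a (n * m) (f ^ m) = homogenize_poly a n f ^ m"
proof (induction m)
  case 0
  then show ?case by (simp add: homogenize_poly_def monom_0 one_pCons)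
next
  case (Suc m)
  then show ?case
    using homogenize_poly_mult[OF assms degree_power_le_mult[OF assms, of m]]
    by simp
qed

lemma coeff_zderiv: "coeff (zderiv p) i = of_nat (Suc i) * coeff p (Suc i)"
  by (auto simp: zderiv_def coeff_sum coeff_eq_0)

text \<open>The factor \<open>k! a^(n - k)\<close> makes each summand a difference of consecutive
  terms \<open>k! a^(n + 1 - k) h k\<close>. \<open>h\<close> is any sequence, so this also covers a
  formal solution not yet known to be a polynomial.\<close>

lemma factorial_sum_telescope:
  fixes h c :: "nat \<Rightarrow> 'a::comm_ring_1"
  assumes "\<And>k. k \<le> n \<Longrightarrow> c k = of_nat (Suc k) * h (Suc k) - a * h k"
  shows "(\<Sum>k\<le>n. of_nat (fact k) * (a ^ (n - k) * c k)) = of_nat (fact (Suc n)) * h (Suc n) - a ^ Suc n * h 0"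
  using assms
proof (induction n)
  case (Suc n)
  have "(\<Sum>k\<le>n. of_nat (fact k) * (a ^ (Suc n - k) * c k)) = a * (\<Sum>k\<le>n. of_nat (fact k) * (a ^ (n - k) * c k))"
    by (auto simp: sum_distrib_left Suc_diff_le mult_ac intro!: sum.cong)
  also have "\<dots> = a * (of_nat (fact (Suc n)) * h (Suc n) - a ^ Suc n * h 0)"
    using Suc by simp
  finally have "(\<Sum>k\<le>Suc n. of_nat (fact k) * (a ^ (Suc n - k) * c k)) =
      a * (of_nat (fact (Suc n)) * h (Suc n) - a ^ Suc n * h 0) + of_nat (fact (Suc n)) * c (Suc n)"
    by simp
  also have "c (Suc n) = of_nat (Suc (Suc n)) * h (Suc (Suc n)) - a * h (Suc n)"
    using Suc.prems by blast
  also have "a * (of_nat (fact (Suc n)) * h (Suc n) - a ^ Suc n * h 0)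
      + of_nat (fact (Suc n)) * (of_nat (Suc (Suc n)) * h (Suc (Suc n)) - a * h (Suc n))
      = of_nat (Suc (Suc n)) * of_nat (fact (Suc n)) * h (Suc (Suc n)) - a ^ Suc (Suc n) * h 0"
    by (simp only: right_diff_distrib power_Suc mult_ac) simp
  also have "of_nat (Suc (Suc n)) * of_nat (fact (Suc n)) = (of_nat (fact (Suc (Suc n))) :: 'a)"
    by (simp only: fact_Suc[of "Suc n"] of_nat_mult of_nat_id)
  finally show ?case .
qed (auto simp: algebra_simps)

text \<open>Comparing coefficients determines \<open>h\<close> from \<open>h 0\<close>, and
  \<open>h\<close> is a polynomial exactly when \<open>h (n + 1) = 0\<close>. By telescoping, the
  functional then equals \<open>- a^(n + 1) * h 0\<close>.\<close>

lemma range_zderiv_iff: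
  fixes a :: "'a::comm_ring_1"
  assumes Q: "rat_algebra TYPE('a)" and nzd: "\<forall>x::'a. a * x = 0 \<longrightarrow> x = 0"
    and deg: "degree f \<le> n"
  shows "f \<in> range (\<lambda>h. zderiv h - [:a:] * h) \<longleftrightarrow>
         a ^ Suc n dvd factorial_functional (homogenize_poly a n f)"
proof -
  have L: "factorial_functional (homogenize_poly a n f) = (\<Sum>k\<le>n. of_nat (fact k) * (a ^ (n - k) * coeff f k))"
    by (simp add: factorial_functional_eq[OF degree_homogenize_poly] coeff_homogenize_poly)
  show ?thesis
  proof
    assume "f \<in> range (\<lambda>h. zderiv h - [:a:] * h)"
    then obtain h where h: "f = zderiv h - [:a:] * h" by blast
    have rec: "coeff f k = of_nat (Suc k) * coeff h (Suc k) - a * coeff h k" for k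
      by (simp add: h coeff_zderiv)
    \<comment> \<open>If \<open>h\<close> had degree above \<open>n\<close>, its leading coefficient
      would be annihilated by \<open>a\<close>.\<close>
    have "coeff h (Suc n) = 0"
    proof (rule ccontr)
      assume "coeff h (Suc n) \<noteq> 0"
      then have "Suc n \<le> degree h" by (rule le_degree)
      then have "coeff f (degree h) = 0" using deg by (intro coeff_eq_0) linarith
      then have "a * coeff h (degree h) = 0"
        using rec[of "degree h"] by (simp add: coeff_eq_0)
      then have "coeff h (degree h) = 0" using nzd by blast
      with \<open>Suc n \<le> degree h\<close> show False by auto
    qed
    then show "a ^ Suc n dvd factorial_functional (homogenize_poly a n f)"
      unfolding L by (subst factorial_sum_telescope[of n _ "coeff h"]) (use rec in auto)
  next
    assume "a ^ Suc n dvd factorial_functional (homogenize_poly a n f)"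
    then obtain y where y: "factorial_functional (homogenize_poly a n f) = a ^ Suc n * y" by (rule dvdE)
    have "\<exists>u::'a. of_nat (Suc k) * u = 1" for k
      using rat_algebra_inverse[OF Q, of "Suc k"] by blast
    then obtain u :: "nat \<Rightarrow> 'a" where u: "\<And>k. of_nat (Suc k) * u k = 1" by metis
    \<comment> \<open>Telescoping forces the start \<open>- y\<close> if \<open>h (Suc n)\<close> is
      to vanish; later values solve the recurrence by inverting \<open>Suc k\<close>.\<close>
    define h where "h = rec_nat (- y) (\<lambda>k x. u k * (coeff f k + a * x))"
    have h0: "h 0 = - y" and hS: "h (Suc k) = u k * (coeff f k + a * h k)" for k
      by (simp_all add: h_def)
    have rec: "coeff f k = of_nat (Suc k) * h (Suc k) - a * h k" for k
      unfolding hS mult.assoc[symmetric] u by simp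
    have "of_nat (fact (Suc n)) * h (Suc n) = 0"
      using factorial_sum_telescope[of n "coeff f" h a] rec y L h0 by simp
    moreover obtain v :: 'a where "of_nat (fact (Suc n)) * v = 1"
      by (rule rat_algebra_inverse[OF Q fact_gt_zero])
    ultimately have hSn: "h (Suc n) = 0"
      by (metis mult.commute mult.left_commute mult_1 mult_zero_left)
    have "h k = 0" if "k \<ge> Suc n" for k
      using that
    proof (induction k rule: dec_induct)
      case (step k)
      then have "coeff f k = 0" using deg by (intro coeff_eq_0) linarith
      then show ?case using step by (simp add: hS)
    qed (rule hSn)
    then have coeff_h: "coeff (\<Sum>k\<le>n. monom (h k) k) k = h k" for k
      by (simp add: coeff_sum)
    have "f = zderiv (\<Sum>k\<le>n. monom (h k) k) - [:a:] * (\<Sum>k\<le>n. monom (h k) k)"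
      by (rule poly_eqI) (simp add: coeff_zderiv coeff_h rec)
    then show "f \<in> range (\<lambda>h. zderiv h - [:a:] * h)" by blast
  qed
qed

lemma rat_subspace_range_zderiv:
  fixes a :: "'a::comm_ring_1"
  assumes Q: "rat_algebra TYPE('a)"
  shows "rat_subspace (range (\<lambda>h. zderiv h - [:a:] * h))"
proof -
  let ?D = "\<lambda>h. zderiv h - [:a:] * h"
  have add: "?D (p + q) = ?D p + ?D q" and minus: "?D (- p) = - ?D p"
    and smult: "?D (smult c p) = smult c (?D p)" for p q c
    by (rule poly_eqI; simp add: coeff_zderiv algebra_simps)+
  have "y \<in> range ?D" if n: "n > 0" and y: "of_nat n * y \<in> range ?D" for n y
  proof -
    obtain u :: 'a where u: "of_nat n * u = 1" by (rule rat_algebra_inverse[OF Q n])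
    obtain h where h: "of_nat n * y = ?D h" using y by blast
    have "y = smult u (of_nat n * y)"
      using u by (simp add: of_nat_poly mult.commute)
    also have "\<dots> = ?D (smult u h)" unfolding h smult ..
    finally show ?thesis by blast
  qed
  moreover have "0 \<in> range ?D"
    by (rule range_eqI[of _ _ 0]) (rule poly_eqI, simp add: coeff_zderiv)
  moreover have "x + y \<in> range ?D" if "x \<in> range ?D" "y \<in> range ?D" for x y
  proof -
    obtain p q where "x = ?D p" "y = ?D q" using \<open>x \<in> _\<close> \<open>y \<in> _\<close> by (elim rangeE)
    then show ?thesis by (intro range_eqI[of _ _ "p + q"]) (simp only: add)
  qed
  moreover have "- x \<in> range ?D" if "x \<in> range ?D" for x
  proof -
    obtain p where "x = ?D p" using \<open>x \<in> _\<close> by (elim rangeE)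
    then show ?thesis by (intro range_eqI[of _ _ "- p"]) (simp only: minus)
  qed
  ultimately show ?thesis
    unfolding rat_subspace_def by blast
qed

lemma mathieu_subspace_range_zderiv_if:
  fixes a :: "'a::comm_ring_1"
  assumes Q: "rat_algebra TYPE('a)" and nzd: "\<forall>x::'a. a * x = 0 \<longrightarrow> x = 0"
    and FC: "\<And>p i. (\<And>m. m \<ge> 1 \<Longrightarrow> a dvd factorial_functional (p ^ m)) \<Longrightarrow> a dvd coeff p i"
  shows "mathieu_subspace (range (\<lambda>h::'a poly. zderiv h - [:a:] * h))"
  unfolding mathieu_subspace_def
proof (intro conjI rat_subspace_range_zderiv Q allI impI)
  fix f g :: "'a poly"
  assume f: "\<forall>m\<ge>1. f ^ m \<in> range (\<lambda>h. zderiv h - [:a:] * h)"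
  define d e where "d = degree f" and "e = degree g"
  let ?F = "homogenize_poly a d f" and ?G = "homogenize_poly a e g"
  have cancel: "x dvd y" if "a ^ k * x dvd a ^ k * y" for k and x y :: 'a
    using that
  proof (induction k)
    case (Suc k)
    then obtain w where "a ^ Suc k * y = a ^ Suc k * x * w" by (elim dvdE)
    then have "a * (a ^ k * y - a ^ k * x * w) = 0" by (simp add: algebra_simps)
    then have "a ^ k * y = a ^ k * x * w" using nzd by fastforce
    then show ?case using Suc.IH by simp
  qed simp
  have F: "a ^ Suc (d * m) dvd factorial_functional (?F ^ m)" if "m \<ge> 1" for m
    using f that range_zderiv_iff[OF Q nzd degree_power_le_mult[of f d m]]
    by (simp add: d_def homogenize_poly_power)
  \<comment> \<open>While \<open>s \<le> d\<close>, cancelling \<open>a ^ (s * m)\<close> from the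
    \<open>d * m + 1\<close> available factors \<open>a\<close> leaves at least one, so
    \<open>FC\<close> permits one more division; thus \<open>s\<close> can reach
    \<open>Suc d\<close>.\<close>
  have "\<exists>p. ?F = smult (a ^ s) p" if "s \<le> Suc d" for s
    using that
  proof (induction s)
    case (Suc s)
    then obtain p where p: "?F = smult (a ^ s) p" by auto
    have "a dvd factorial_functional (p ^ m)" if "m \<ge> 1" for m
    proof -
      have "s * m + 1 \<le> Suc (d * m)" using Suc.prems by simp
      then have "a ^ (s * m + 1) dvd factorial_functional (?F ^ m)"
        using F[OF that] by (meson power_le_dvd)
      also have "factorial_functional (?F ^ m) = a ^ (s * m) * factorial_functional (p ^ m)"
        by (simp add: p smult_power factorial_functional_smult flip: power_mult)
      finally show ?thesis using cancel[of "s * m" a] by (simp add: mult.commute)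
    qed
    then have "a dvd coeff p i" for i by (rule FC)
    then obtain w where w: "\<And>i. coeff p i = a * w i" unfolding dvd_def by metis
    define q where "q = (\<Sum>i\<le>degree p. monom (w i) i)"
    have "coeff p i = a * coeff q i" for i
      using w[of i] by (auto simp: q_def coeff_sum coeff_eq_0)
    then have "p = smult a q" by (intro poly_eqI) simp
    then show ?case using p by (intro exI[of _ q]) (simp add: mult.commute)
  qed (auto intro: exI[of _ "?F"])
  then obtain p where p: "?F = smult (a ^ Suc d) p" by blast
  have "f ^ m * g \<in> range (\<lambda>h. zderiv h - [:a:] * h)" if m: "m \<ge> Suc e" for m
  proof -
    have deg: "degree (f ^ m) \<le> d * m" by (rule degree_power_le_mult) (simp add: d_def)
    have deg': "degree (f ^ m * g) \<le> d * m + e"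
      using degree_mult_le[of "f ^ m" g] deg by (simp add: e_def)
    have "homogenize_poly a (d * m + e) (f ^ m * g) = smult (a ^ (Suc d * m)) (p ^ m * ?G)"
      using deg by (simp only: homogenize_poly_mult[of _ _ g e] homogenize_poly_power[of f d]
          d_def[symmetric] e_def[symmetric] order_refl p smult_power power_mult mult_smult_left)
    then have "factorial_functional (homogenize_poly a (d * m + e) (f ^ m * g))
        = a ^ (Suc d * m) * factorial_functional (p ^ m * ?G)"
      by (simp only: factorial_functional_smult)
    \<comment> \<open>The exponent \<open>(d + 1) m\<close> reaches the required
      \<open>d m + e + 1\<close> exactly when \<open>m > e\<close>, whence the threshold
      \<open>Suc e\<close>.\<close>
    moreover have "a ^ Suc (d * m + e) dvd a ^ (Suc d * m)"
      using m by (intro le_imp_power_dvd) simp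
    ultimately show ?thesis
      unfolding range_zderiv_iff[OF Q nzd deg'] by simp
  qed
  then show "\<exists>N. \<forall>m\<ge>N. f ^ m * g \<in> range (\<lambda>h. zderiv h - [:a:] * h)" by blast
qed

theorem theorem2p8:
  fixes a :: "'a::comm_ring_1"
  assumes "rat_algebra TYPE('a)"
    and "\<forall>x::'a. a * x = 0 \<longrightarrow> x = 0"
    and "\<forall>(x::'a) (n::nat). n \<ge> 1 \<and> a dvd x ^ n \<longrightarrow> a dvd x"
  shows "mathieu_subspace (range (\<lambda>h::'a poly. zderiv h - [:a:] * h))"
  using assms(1,2) factorial_functional_power_dvd[OF assms(1,3)] by (rule mathieu_subspace_range_zderiv_if)

end
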